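(* For every positive integer $n$, there is a bijection between the set $\mathrm{PPF}_n$ of prime parking functions on $n$ cars and the set $\mathrm{PF}_{n\mid [n]\setminus\{2\}}$ of $[n]\setminus\{2\}$-restricted parking functions on $n$ cars.
   Context: $[n]=\{1,\dots,n\}$. A parking function on $n$ cars is a function $\pi:[n]\to[n]$ such that $\#\pi^{-1}([i])\ge i$ for every $i\in[n]$. For $S\subseteq[n]$, an $S$-restricted parking function on $n$ cars is a parking function on $n$ cars whose image is contained in $S$; the set of these is $\mathrm{PF}_{n\mid S}$. A prime parking function on $n$ cars is a function $\pi:[n]\to[n]$ such that $\#\pi^{-1}([i])>i$ for every $i\in[n-1]$ (for $n=1$, the unique function $[1]\to[1]$ is regarded as prime). *)

theory Defs
  imports Main "HOL-Library.FuncSet"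
begin

(* A function from {1..n} to {1..n} is represented by its extensional version, an element of
   {1..n} \<rightarrow>\<^sub>E {1..n} (value undefined outside {1..n}), so that distinct elements
   of these sets are distinct functions on {1..n}. *)

definition parking_functions :: "nat \<Rightarrow> (nat \<Rightarrow> nat) set" where
  "parking_functions n =
     {\<pi> \<in> {1..n} \<rightarrow>\<^sub>E {1..n}. \<forall>i\<in>{1..n}. i \<le> card {k \<in> {1..n}. \<pi> k \<in> {1..i}}}"

definition restricted_parking_functions :: "nat \<Rightarrow> nat set \<Rightarrow> (nat \<Rightarrow> nat) set" where
  "restricted_parking_functions n S = {\<pi> \<in> parking_functions n. \<pi> ` {1..n} \<subseteq> S}"

(* For n = 1 the condition is vacuous, so the unique function on {1} is prime, as intended. *)
definition prime_parking_functions :: "nat \<Rightarrow> (nat \<Rightarrow> nat) set" where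
  "prime_parking_functions n =
     {\<pi> \<in> {1..n} \<rightarrow>\<^sub>E {1..n}. \<forall>i\<in>{1..n-1}. i < card {k \<in> {1..n}. \<pi> k \<in> {1..i}}}"

end

theory Submission
  imports Defs
begin

text \<open>Relabel the values of a function by fixing 1 and moving every \<open>v \<ge> 2\<close> to \<open>v + 1\<close>. For
  \<open>i \<ge> 1\<close>, the cars with preference at most \<open>i\<close> before the relabelling are those with preference
  at most \<open>i + 1\<close> after it, so the primality condition at \<open>i\<close> is the parking condition at
  \<open>i + 1\<close>. The relabelled values stay in range because a prime parking function on \<open>n \<ge> 2\<close>
  cars never takes the value \<open>n\<close>.\<close>

definition skip_two :: "nat \<Rightarrow> nat" where
  "skip_two v = (if v = 1 then 1 else v + 1)"

text \<open>Both 1 and 2 are sent to 1, so this inverts \<open>skip_two\<close> only where the value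
  2 is avoided.\<close>

definition unskip_two :: "nat \<Rightarrow> nat" where
  "unskip_two v = (if v = 1 then 1 else v - 1)"

lemma unskip_two_skip_two: "v \<ge> 1 \<Longrightarrow> unskip_two (skip_two v) = v"
  by (simp add: skip_two_def unskip_two_def)

lemma skip_two_unskip_two: "v \<ge> 1 \<Longrightarrow> v \<noteq> 2 \<Longrightarrow> skip_two (unskip_two v) = v"
  by (auto simp: skip_two_def unskip_two_def)

text \<open>The disjunct \<open>v = 0\<close> is there because \<open>skip_two 0 = 1\<close>; it
  drops out for values of a parking function, which are at least 1.\<close>

lemma skip_two_mem_iff: "i \<ge> 1 \<Longrightarrow> skip_two v \<in> {1..Suc i} \<longleftrightarrow> v \<in> {1..i} \<or> v = 0"
  by (auto simp: skip_two_def)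

lemma unskip_two_mem_iff: "i \<ge> 1 \<Longrightarrow> v \<noteq> 2 \<Longrightarrow> unskip_two v \<in> {1..i} \<longleftrightarrow> v \<in> {1..Suc i}"
  by (auto simp: unskip_two_def)

text \<open>Primality at \<open>n - 1\<close> asks for more than \<open>n - 1\<close> cars with
  preference at most \<open>n - 1\<close>, which must then be all \<open>n\<close> cars.\<close>

lemma prime_parking_function_less:
  assumes "\<pi> \<in> prime_parking_functions n" "n \<ge> 2" "k \<in> {1..n}"
  shows "\<pi> k < n"
proof -
  let ?A = "{k \<in> {1..n}. \<pi> k \<in> {1..n-1}}"
  have "n - 1 < card ?A"
    using assms by (auto simp: prime_parking_functions_def)
  then have "?A = {1..n}"
    by (intro card_seteq) auto
  with \<open>k \<in> {1..n}\<close> have "\<pi> k \<in> {1..n-1}"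
    by blast
  with \<open>n \<ge> 2\<close> show ?thesis by auto
qed

lemma skip_two_prime_parking_function:
  assumes "\<pi> \<in> prime_parking_functions n"
  shows "restrict (skip_two \<circ> \<pi>) {1..n} \<in> restricted_parking_functions n ({1..n} - {2})"
proof -
  let ?\<sigma> = "restrict (skip_two \<circ> \<pi>) {1..n}"
  have \<pi>: "\<pi> k \<in> {1..n}" if "k \<in> {1..n}" for k
    using assms that by (auto simp: prime_parking_functions_def)
  have val: "skip_two (\<pi> k) \<in> {1..n} - {2}" if "k \<in> {1..n}" for k
  proof (cases "n \<ge> 2")
    case True
    with prime_parking_function_less[OF assms True that] \<pi>[OF that] show ?thesis
      by (auto simp: skip_two_def)
  next
    case False
    with \<pi>[OF that] show ?thesis by (auto simp: skip_two_def)
  qed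
  \<comment> \<open>The strict inequality of primality at \<open>i\<close> supplies exactly the one
    extra car needed at \<open>Suc i\<close>.\<close>
  have succ: "Suc i \<le> card {k \<in> {1..n}. ?\<sigma> k \<in> {1..Suc i}}" if "i \<in> {1..n-1}" for i
  proof -
    have "{k \<in> {1..n}. ?\<sigma> k \<in> {1..Suc i}} = {k \<in> {1..n}. \<pi> k \<in> {1..i}}"
    proof (rule Collect_cong, rule conj_cong[OF refl])
      fix k assume "k \<in> {1..n}"
      with that \<pi>[of k] show "?\<sigma> k \<in> {1..Suc i} \<longleftrightarrow> \<pi> k \<in> {1..i}"
        using skip_two_mem_iff[of i "\<pi> k"] by auto
    qed
    with that assms show ?thesis by (simp add: prime_parking_functions_def Suc_le_eq)
  qed
  \<comment> \<open>The shift does not reach the parking condition at 1. It follows from primality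
    at 1, since among positive values only 1 is relabelled to 1.\<close>
  have one: "1 \<le> card {k \<in> {1..n}. ?\<sigma> k \<in> {1..1}}" if "n \<ge> 1"
  proof (cases "n \<ge> 2")
    case True
    have "{k \<in> {1..n}. ?\<sigma> k \<in> {1..1}} = {k \<in> {1..n}. \<pi> k \<in> {1..1}}"
    proof (rule Collect_cong, rule conj_cong[OF refl])
      fix k assume "k \<in> {1..n}"
      with \<pi>[of k] show "?\<sigma> k \<in> {1..1} \<longleftrightarrow> \<pi> k \<in> {1..1}"
        by (simp add: skip_two_def)
    qed
    moreover have "1 \<in> {1..n-1}"
      using True by simp
    then have "1 < card {k \<in> {1..n}. \<pi> k \<in> {1..1}}"
      using assms unfolding prime_parking_functions_def by blast
    ultimately show ?thesis by (simp only: less_imp_le)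
  next
    \<comment> \<open>Primality is vacuous for one car, but the only possible preference is
      1.\<close>
    case False
    with that have "n = 1" by simp
    with \<pi>[of 1] have "{k \<in> {1..n}. ?\<sigma> k \<in> {1..1}} = {1}"
      by (auto simp: skip_two_def)
    then show ?thesis by simp
  qed
  have "i \<le> card {k \<in> {1..n}. ?\<sigma> k \<in> {1..i}}" if "i \<in> {1..n}" for i
  proof (cases "i = 1")
    case True
    with one that show ?thesis by simp
  next
    case False
    with that have "i - 1 \<in> {1..n-1}" and "Suc (i - 1) = i"
      by auto
    with succ[of "i - 1"] show ?thesis by simp
  qed
  moreover have "?\<sigma> \<in> {1..n} \<rightarrow>\<^sub>E {1..n}" "?\<sigma> ` {1..n} \<subseteq> {1..n} - {2}"
    using val by (auto simp del: atLeastAtMost_iff)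
  ultimately show ?thesis
    unfolding restricted_parking_functions_def parking_functions_def by blast
qed

lemma unskip_two_restricted_parking_function:
  assumes "\<sigma> \<in> restricted_parking_functions n ({1..n} - {2})"
  shows "restrict (unskip_two \<circ> \<sigma>) {1..n} \<in> prime_parking_functions n"
proof -
  let ?\<pi> = "restrict (unskip_two \<circ> \<sigma>) {1..n}"
  have \<sigma>: "\<sigma> k \<in> {1..n} - {2}" if "k \<in> {1..n}" for k
    using assms that unfolding restricted_parking_functions_def by blast
  have "i < card {k \<in> {1..n}. ?\<pi> k \<in> {1..i}}" if "i \<in> {1..n-1}" for i
  proof -
    \<comment> \<open>Up to \<open>Suc i\<close>, the values of \<sigma> lie among 1 and 3, ...,
      \<open>Suc i\<close>, which relabel to 1, ..., \<open>i\<close>; the same cars are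
      counted.\<close>
    have "{k \<in> {1..n}. ?\<pi> k \<in> {1..i}} = {k \<in> {1..n}. \<sigma> k \<in> {1..Suc i}}"
    proof (rule Collect_cong, rule conj_cong[OF refl])
      fix k assume "k \<in> {1..n}"
      with that \<sigma>[of k] show "?\<pi> k \<in> {1..i} \<longleftrightarrow> \<sigma> k \<in> {1..Suc i}"
        using unskip_two_mem_iff[of i "\<sigma> k"] by auto
    qed
    moreover have "Suc i \<in> {1..n}"
      using that by auto
    then have "Suc i \<le> card {k \<in> {1..n}. \<sigma> k \<in> {1..Suc i}}"
      using assms unfolding restricted_parking_functions_def parking_functions_def by blast
    ultimately show ?thesis by (simp only: Suc_le_eq)
  qed
  moreover have "unskip_two (\<sigma> k) \<in> {1..n}" if "k \<in> {1..n}" for k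
    using \<sigma>[OF that] by (auto simp: unskip_two_def)
  then have "?\<pi> \<in> {1..n} \<rightarrow>\<^sub>E {1..n}"
    by (auto simp del: atLeastAtMost_iff)
  ultimately show ?thesis
    unfolding prime_parking_functions_def by blast
qed

theorem theorem4:
  fixes n :: nat
  assumes "n \<ge> 1"
  shows "\<exists>f. bij_betw f (prime_parking_functions n)
                    (restricted_parking_functions n ({1..n} - {2}))"
proof
  show "bij_betw (\<lambda>\<pi>. restrict (skip_two \<circ> \<pi>) {1..n}) (prime_parking_functions n)
          (restricted_parking_functions n ({1..n} - {2}))"
  proof (rule bij_betw_byWitness[where f' = "\<lambda>\<sigma>. restrict (unskip_two \<circ> \<sigma>) {1..n}"])
    show "\<forall>\<pi>\<in>prime_parking_functions n.
            restrict (unskip_two \<circ> restrict (skip_two \<circ> \<pi>) {1..n}) {1..n} = \<pi>"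
    proof
      fix \<pi> assume "\<pi> \<in> prime_parking_functions n"
      then have \<pi>: "\<pi> \<in> {1..n} \<rightarrow>\<^sub>E {1..n}"
        by (simp add: prime_parking_functions_def)
      have "unskip_two (skip_two (\<pi> k)) = \<pi> k" if "k \<in> {1..n}" for k
        using PiE_mem[OF \<pi> that] by (simp add: unskip_two_skip_two)
      then show "restrict (unskip_two \<circ> restrict (skip_two \<circ> \<pi>) {1..n}) {1..n} = \<pi>"
        \<comment> \<open>Both sides are \<open>undefined\<close> outside \<open>{1..n}\<close>, so
          agreement on the cars suffices.\<close>
        by (intro extensionalityI[of _ "{1..n}"]) (use \<pi> in \<open>auto simp: PiE_def\<close>)
    qed
    show "\<forall>\<sigma>\<in>restricted_parking_functions n ({1..n} - {2}).
            restrict (skip_two \<circ> restrict (unskip_two \<circ> \<sigma>) {1..n}) {1..n} = \<sigma>"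
    proof
      fix \<sigma> assume "\<sigma> \<in> restricted_parking_functions n ({1..n} - {2})"
      then have \<sigma>: "\<sigma> \<in> {1..n} \<rightarrow>\<^sub>E {1..n}" and img: "\<sigma> ` {1..n} \<subseteq> {1..n} - {2}"
        by (simp_all add: restricted_parking_functions_def parking_functions_def)
      have "skip_two (unskip_two (\<sigma> k)) = \<sigma> k" if "k \<in> {1..n}" for k
        using subsetD[OF img imageI[OF that]] by (simp add: skip_two_unskip_two)
      then show "restrict (skip_two \<circ> restrict (unskip_two \<circ> \<sigma>) {1..n}) {1..n} = \<sigma>"
        by (intro extensionalityI[of _ "{1..n}"]) (use \<sigma> in \<open>auto simp: PiE_def\<close>)
    qed
  \<comment> \<open>What remains is that each of the two maps sends its domain into the other
    set.\<close>
  qed (use skip_two_prime_parking_function unskip_two_restricted_parking_function in blast)+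
qed

end
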